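(* The construction $\mathbf{P}$ is a functor from the category of monoids to the category of clones: for every monoid $M$, $\mathbf{P}(M)$ is a clone; for every monoid morphism $\phi:M\to M'$, $\mathbf{P}(\phi)$ is a clone morphism; $\mathbf{P}(\phi'\circ\phi)=\mathbf{P}(\phi')\circ\mathbf{P}(\phi)$ and $\mathbf{P}(\mathrm{id}_M)=\mathrm{id}_{\mathbf{P}(M)}$. Moreover, this functor preserves injections and surjections: if $\phi$ is injective (resp. surjective), then $\mathbf{P}(\phi)$ is injective (resp. surjective).
   Context: A clone $C$ is a graded set $\bigsqcup_{n\ge0}C(n)$ with superposition maps $C(n)\times C(m)^n\to C(m)$, $x[y_1,\dots,y_n]$, and projections $\mathbf{1}_{i,n}\in C(n)$ ($n\ge1$, $i\in[n]$) satisfying $\mathbf{1}_{i,n}[y_1,\dots,y_n]=y_i$, $x[\mathbf{1}_{1,n},\dots,\mathbf{1}_{n,n}]=x$ and $x[y_1,\dots,y_n][z_1,\dots,z_m]=x[y_1[z_1,\dots,z_m],\dots,y_n[z_1,\dots,z_m]]$. A clone morphism is an arity-preserving map sending projections to projections and commuting with superposition. For a monoid $(M,\cdot,e)$: an $M$-pigmented letter is a pair $i^\alpha$ with $i$ a positive integer and $\alpha\in M$; $\mathbf{P}(M)(n)$ is the set of words of $M$-pigmented letters with values in $[n]$. For $\alpha\in M$, $\alpha\odot i_1^{\alpha_1}\cdots i_\ell^{\alpha_\ell}:=i_1^{\alpha\cdot\alpha_1}\cdots i_\ell^{\alpha\cdot\alpha_\ell}$. Superposition: $i_1^{\alpha_1}\cdots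 i_\ell^{\alpha_\ell}[\mathfrak{p}_1,\dots,\mathfrak{p}_n]:=(\alpha_1\odot\mathfrak{p}_{i_1})\cdots(\alpha_\ell\odot\mathfrak{p}_{i_\ell})$ (concatenation); projections $\mathbf{1}_{i,n}:=i^e$. For a monoid morphism $\phi:M\to M'$, $\mathbf{P}(\phi)(i_1^{\alpha_1}\cdots i_\ell^{\alpha_\ell}):=i_1^{\phi(\alpha_1)}\cdots i_\ell^{\phi(\alpha_\ell)}$. *)

theory Defs
  imports "HOL-Algebra.Group"
begin

text \<open>
  A graded set is a family of carriers indexed by arity; nothing requires the carriers to be
  disjoint as sets, since an element is always considered together with its arity.
  Tuples are lists, \<open>superp C n m\<close> is the map \<open>C(n) \<times> C(m)\<^sup>n \<rightarrow> C(m)\<close> and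
  \<open>proj C i n\<close> is the projection \<open>\<one>\<^sub>i\<^sub>,\<^sub>n\<close>, with \<open>i\<close> counted from 1.
\<close>

record 'c clone_struct =
  elems :: "nat \<Rightarrow> 'c set"
  superp :: "nat \<Rightarrow> nat \<Rightarrow> 'c \<Rightarrow> 'c list \<Rightarrow> 'c"
  proj :: "nat \<Rightarrow> nat \<Rightarrow> 'c"

definition tuples :: "'c set \<Rightarrow> nat \<Rightarrow> 'c list set" where
  "tuples A n = {ys. length ys = n \<and> set ys \<subseteq> A}"

locale clone =
  fixes C :: "('c, 'x) clone_struct_scheme"
  assumes superp_closed:
      "\<lbrakk>x \<in> elems C n; ys \<in> tuples (elems C m) n\<rbrakk> \<Longrightarrow> superp C n m x ys \<in> elems C m"
    and proj_closed:
      "i \<in> {1..n} \<Longrightarrow> proj C i n \<in> elems C n"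
    and superp_proj_left:
      "\<lbrakk>i \<in> {1..n}; ys \<in> tuples (elems C m) n\<rbrakk> \<Longrightarrow> superp C n m (proj C i n) ys = ys ! (i - 1)"
    and superp_proj_right:
      "x \<in> elems C n \<Longrightarrow> superp C n n x (map (\<lambda>i. proj C i n) [1..<n + 1]) = x"
    and superp_assoc:
      "\<lbrakk>x \<in> elems C n; ys \<in> tuples (elems C m) n; zs \<in> tuples (elems C k) m\<rbrakk> \<Longrightarrow>
        superp C m k (superp C n m x ys) zs = superp C n k x (map (\<lambda>y. superp C m k y zs) ys)"

text \<open>
  An arity-preserving map is a family of maps between the carriers.  The maps are extensional,
  so that equality in HOL is equality of clone morphisms.
\<close>

definition clone_hom ::
    "('c, 'x) clone_struct_scheme \<Rightarrow> ('d, 'y) clone_struct_scheme \<Rightarrow> (nat \<Rightarrow> 'c \<Rightarrow> 'd) set" where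
  "clone_hom C D = {f.
     (\<forall>n. f n \<in> elems C n \<rightarrow>\<^sub>E elems D n) \<and>
     (\<forall>n. \<forall>i \<in> {1..n}. f n (proj C i n) = proj D i n) \<and>
     (\<forall>n m. \<forall>x \<in> elems C n. \<forall>ys \<in> tuples (elems C m) n.
        f m (superp C n m x ys) = superp D n m (f n x) (map (f m) ys))}"

definition clone_id :: "('c, 'x) clone_struct_scheme \<Rightarrow> nat \<Rightarrow> 'c \<Rightarrow> 'c" where
  "clone_id C = (\<lambda>n. \<lambda>x \<in> elems C n. x)"

definition clone_compose ::
    "('c, 'x) clone_struct_scheme \<Rightarrow> (nat \<Rightarrow> 'd \<Rightarrow> 'e) \<Rightarrow> (nat \<Rightarrow> 'c \<Rightarrow> 'd) \<Rightarrow> nat \<Rightarrow> 'c \<Rightarrow> 'e" where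
  "clone_compose C g f = (\<lambda>n. compose (elems C n) (g n) (f n))"

text \<open>\<^const>\<open>hom\<close> alone does not require the unit of a monoid to be preserved.\<close>

definition monoid_hom ::
    "('a, 'x) monoid_scheme \<Rightarrow> ('b, 'y) monoid_scheme \<Rightarrow> ('a \<Rightarrow> 'b) set" where
  "monoid_hom M N = {\<phi> \<in> hom M N. \<phi> \<one>\<^bsub>M\<^esub> = \<one>\<^bsub>N\<^esub>}"

text \<open>The pigmented letter \<open>i\<^sup>\<alpha>\<close> is the pair \<open>(i, \<alpha>)\<close>.\<close>

type_synonym 'a pword = "(nat \<times> 'a) list"

definition pact :: "('a, 'x) monoid_scheme \<Rightarrow> 'a \<Rightarrow> 'a pword \<Rightarrow> 'a pword" where
  "pact M \<alpha> w = map (\<lambda>(i, \<beta>). (i, \<alpha> \<otimes>\<^bsub>M\<^esub> \<beta>)) w"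

definition pclone :: "('a, 'x) monoid_scheme \<Rightarrow> 'a pword clone_struct" where
  "pclone M =
    \<lparr>elems = (\<lambda>n. lists ({1..n} \<times> carrier M)),
     superp = (\<lambda>n m w ps. concat (map (\<lambda>(i, \<alpha>). pact M \<alpha> (ps ! (i - 1))) w)),
     proj = (\<lambda>i n. [(i, \<one>\<^bsub>M\<^esub>)])\<rparr>"

definition pclone_map :: "('a, 'x) monoid_scheme \<Rightarrow> ('a \<Rightarrow> 'b) \<Rightarrow> nat \<Rightarrow> 'a pword \<Rightarrow> 'b pword" where
  "pclone_map M \<phi> = (\<lambda>n. \<lambda>w \<in> elems (pclone M) n. map (\<lambda>(i, \<alpha>). (i, \<phi> \<alpha>)) w)"

end

theory Submission
  imports Defs
begin

text \<open>The words of arity \<open>n\<close> form the free monoid on the letters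
  \<open>(i, \<alpha>)\<close>, and \<open>pact\<close> is a left action of the monoid on them that
  respects concatenation. For a fixed tuple \<open>ps\<close>, superposition is the concatenation
  morphism sending \<open>(i, \<alpha>)\<close> to the action of \<open>\<alpha>\<close> on the
  \<open>i\<close>-th entry of \<open>ps\<close>. Each clone law therefore only has to be checked on
  single letters, by induction on the word. The left projection law is unitality of the action
  (\<open>pact_one\<close>), and the right one is
  \<open>\<alpha> \<otimes> \<one> = \<alpha>\<close>. Associativity rests on
  \<open>pact_superp\<close>: acting on a superposition amounts to acting on its outer word.

  A monoid morphism applied to all pigments intertwines the two actions, hence commutes with
  superposition (\<open>pclone_map_superp\<close>). Functoriality, injectivity and surjectivity pass
  from pigments to letters and from letters to words.\<close>

lemma elems_pclone: "elems (pclone M) n = lists ({1..n} \<times> carrier M)"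
  by (simp add: pclone_def)

lemma proj_pclone: "proj (pclone M) i n = [(i, \<one>\<^bsub>M\<^esub>)]"
  by (simp add: pclone_def)

lemma superp_pclone_Nil: "superp (pclone M) n m [] ps = []"
  by (simp add: pclone_def)

lemma superp_pclone_Cons:
  "superp (pclone M) n m ((i, \<alpha>) # w) ps = pact M \<alpha> (ps ! (i - 1)) @ superp (pclone M) n m w ps"
  by (simp add: pclone_def)

lemma superp_pclone_append:
  "superp (pclone M) n m (v @ w) ps = superp (pclone M) n m v ps @ superp (pclone M) n m w ps"
  by (simp add: pclone_def)

lemmas pclone_simps =
  elems_pclone proj_pclone superp_pclone_Nil superp_pclone_Cons superp_pclone_append

text \<open>Values of letters count from 1 and list positions from 0. The bound
  \<open>1 \<le> i\<close> excludes \<open>i = 0\<close>, where \<open>i - 1\<close> would truncate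
  to 0.\<close>

lemma tuples_nth: "ys \<in> tuples A n \<Longrightarrow> i \<in> {1..n} \<Longrightarrow> ys ! (i - 1) \<in> A"
  by (auto simp: tuples_def)

lemma pact_append: "pact M \<alpha> (v @ w) = pact M \<alpha> v @ pact M \<alpha> w"
  by (simp add: pact_def)

context monoid
begin

lemma pact_closed:
  "\<alpha> \<in> carrier G \<Longrightarrow> w \<in> lists (A \<times> carrier G) \<Longrightarrow> pact G \<alpha> w \<in> lists (A \<times> carrier G)"
  by (induction w) (auto simp: pact_def)

lemma pact_one: "w \<in> lists (A \<times> carrier G) \<Longrightarrow> pact G \<one> w = w"
  by (induction w) (auto simp: pact_def)

lemma pact_mult:
  "\<alpha> \<in> carrier G \<Longrightarrow> \<beta> \<in> carrier G \<Longrightarrow> w \<in> lists (A \<times> carrier G) \<Longrightarrow>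
    pact G (\<alpha> \<otimes> \<beta>) w = pact G \<alpha> (pact G \<beta> w)"
  by (induction w) (auto simp: pact_def m_assoc)

text \<open>The heart of associativity. On one letter \<open>(i, \<beta>)\<close> it says that
  acting by \<open>\<beta>\<close> and then by \<open>\<alpha>\<close> is acting by
  \<open>\<alpha> \<otimes> \<beta>\<close>, which is \<open>pact_mult\<close>.\<close>

lemma pact_superp:
  assumes "\<alpha> \<in> carrier G" and "w \<in> elems (pclone G) n" and "ps \<in> tuples (elems (pclone G) m) n"
  shows "pact G \<alpha> (superp (pclone G) n m w ps) = superp (pclone G) n m (pact G \<alpha> w) ps"
  using assms(2)
proof (induction w)
  case Nil
  then show ?case by (simp add: pclone_simps pact_def)
next
  case (Cons l w)
  obtain i \<beta> where l: "l = (i, \<beta>)" by (cases l)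
  with Cons.prems have "i \<in> {1..n}" "\<beta> \<in> carrier G" "w \<in> elems (pclone G) n"
    by (auto simp: elems_pclone)
  moreover have "ps ! (i - 1) \<in> lists ({1..m} \<times> carrier G)"
    using tuples_nth[OF assms(3) \<open>i \<in> {1..n}\<close>] by (simp add: elems_pclone)
  moreover have "pact G \<alpha> (l # w) = (i, \<alpha> \<otimes> \<beta>) # pact G \<alpha> w"
    by (simp add: l pact_def)
  ultimately show ?case
    using Cons.IH assms(1) by (simp add: l superp_pclone_Cons pact_append pact_mult)
qed

lemma superp_pclone_closed:
  assumes "w \<in> elems (pclone G) n" and "ps \<in> tuples (elems (pclone G) m) n"
  shows "superp (pclone G) n m w ps \<in> elems (pclone G) m"
  using assms(1)
proof (induction w)
  case Nil
  then show ?case by (simp add: pclone_simps)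
next
  case (Cons l w)
  obtain i \<alpha> where l: "l = (i, \<alpha>)" by (cases l)
  with Cons.prems have "i \<in> {1..n}" "\<alpha> \<in> carrier G" "w \<in> elems (pclone G) n"
    by (auto simp: elems_pclone)
  moreover have "pact G \<alpha> (ps ! (i - 1)) \<in> elems (pclone G) m"
    using tuples_nth[OF assms(2) \<open>i \<in> {1..n}\<close>] \<open>\<alpha> \<in> carrier G\<close>
    unfolding elems_pclone by (intro pact_closed)
  ultimately show ?case
    using Cons.IH by (simp add: l superp_pclone_Cons elems_pclone)
qed

lemma superp_pclone_proj_right:
  assumes "w \<in> elems (pclone G) n"
  shows "superp (pclone G) n n w (map (\<lambda>i. proj (pclone G) i n) [1..<n + 1]) = w"
  using assms
proof (induction w)
  case Nil
  then show ?case by (simp add: pclone_simps)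
next
  case (Cons l w)
  obtain i \<alpha> where l: "l = (i, \<alpha>)" by (cases l)
  with Cons.prems have "i \<in> {1..n}" "\<alpha> \<in> carrier G" "w \<in> elems (pclone G) n"
    by (auto simp: elems_pclone)
  \<comment> \<open>Position \<open>i - 1\<close> of \<open>[1..<n + 1]\<close> holds
    \<open>i\<close>. Without \<open>upt_Suc\<close> the list stays whole, so that it can be indexed
    directly and still matches the induction hypothesis.\<close>
  moreover have "map (\<lambda>i. proj (pclone G) i n) [1..<n + 1] ! (i - 1) = [(i, \<one>)]"
    using \<open>i \<in> {1..n}\<close> by (auto simp: proj_pclone nth_append simp del: upt_Suc)
  ultimately show ?case
    using Cons.IH by (simp add: l superp_pclone_Cons pact_def del: upt_Suc)
qed

text \<open>Both sides turn concatenation of outer words into concatenation. On a letter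
  \<open>(i, \<alpha>)\<close> they differ only in whether \<open>\<alpha>\<close> acts before or
  after \<open>zs\<close> is substituted into \<open>ys ! (i - 1)\<close>, and
  \<open>pact_superp\<close> identifies the two.\<close>

lemma superp_pclone_assoc:
  assumes "w \<in> elems (pclone G) n" and ys: "ys \<in> tuples (elems (pclone G) m) n"
    and zs: "zs \<in> tuples (elems (pclone G) k) m"
  shows "superp (pclone G) m k (superp (pclone G) n m w ys) zs =
    superp (pclone G) n k w (map (\<lambda>y. superp (pclone G) m k y zs) ys)"
  using assms(1)
proof (induction w)
  case Nil
  then show ?case by (simp add: pclone_simps)
next
  case (Cons l w)
  obtain i \<alpha> where l: "l = (i, \<alpha>)" by (cases l)
  with Cons.prems have i: "i \<in> {1..n}" and "\<alpha> \<in> carrier G" "w \<in> elems (pclone G) n"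
    by (auto simp: elems_pclone)
  moreover have "i - 1 < length ys"
    using i ys by (auto simp: tuples_def)
  ultimately show ?case
    using Cons.IH tuples_nth[OF ys i]
    by (simp add: l superp_pclone_Cons superp_pclone_append pact_superp[OF _ _ zs])
qed

lemma clone_pclone: "clone (pclone G)"
proof
  fix i n m ys
  assume i: "i \<in> {1..n}" and ys: "ys \<in> tuples (elems (pclone G) m) n"
  \<comment> \<open>A projection is a single letter with pigment \<open>\<one>\<close>, which acts
    trivially on the selected entry.\<close>
  show "superp (pclone G) n m (proj (pclone G) i n) ys = ys ! (i - 1)"
    using tuples_nth[OF ys i]
    by (simp add: proj_pclone superp_pclone_Cons superp_pclone_Nil elems_pclone pact_one)
qed (use superp_pclone_closed superp_pclone_proj_right superp_pclone_assoc
      in \<open>auto simp: elems_pclone proj_pclone\<close>)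

end

lemma pclone_map_apply:
  "w \<in> elems (pclone M) n \<Longrightarrow> pclone_map M \<phi> n w = map (\<lambda>(i, \<alpha>). (i, \<phi> \<alpha>)) w"
  by (simp add: pclone_map_def)

lemma pclone_map_closed:
  assumes "\<phi> \<in> carrier M \<rightarrow> carrier N"
  shows "pclone_map M \<phi> n \<in> elems (pclone M) n \<rightarrow>\<^sub>E elems (pclone N) n"
  using assms by (fastforce simp: pclone_map_def elems_pclone)

lemma pclone_map_superp:
  assumes M: "monoid M" and \<phi>: "\<phi> \<in> hom M N"
    and w: "w \<in> elems (pclone M) n" and ps: "ps \<in> tuples (elems (pclone M) m) n"
  shows "pclone_map M \<phi> m (superp (pclone M) n m w ps) =
    superp (pclone N) n m (pclone_map M \<phi> n w) (map (pclone_map M \<phi> m) ps)"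
proof -
  \<comment> \<open>The induction uses the unrestricted letterwise map on the words, which unfolds
    without membership conditions; closure under superposition brings \<open>pclone_map\<close> back
    afterwards.\<close>
  have "map (\<lambda>(i, \<alpha>). (i, \<phi> \<alpha>)) (superp (pclone M) n m w ps) =
    superp (pclone N) n m (map (\<lambda>(i, \<alpha>). (i, \<phi> \<alpha>)) w) (map (pclone_map M \<phi> m) ps)"
    using w
  proof (induction w)
    case Nil
    then show ?case by (simp add: pclone_simps)
  next
    case (Cons l w)
    obtain i \<alpha> where l: "l = (i, \<alpha>)" by (cases l)
    with Cons.prems have i: "i \<in> {1..n}" and \<alpha>: "\<alpha> \<in> carrier M" and "w \<in> elems (pclone M) n"
      by (auto simp: elems_pclone)
    moreover have "i - 1 < length ps"
      using i ps by (auto simp: tuples_def)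
    \<comment> \<open>The morphism intertwines the actions; this is where multiplicativity of
      \<open>\<phi>\<close> enters.\<close>
    moreover have "map (\<lambda>(i, \<alpha>). (i, \<phi> \<alpha>)) (pact M \<alpha> p) = pact N (\<phi> \<alpha>) (pclone_map M \<phi> m p)"
      if "p \<in> elems (pclone M) m" for p
      using that hom_mult[OF \<phi> \<alpha>]
      by (auto simp: pclone_map_apply pact_def elems_pclone in_lists_conv_set)
    ultimately show ?case
      using Cons.IH tuples_nth[OF ps i] by (simp add: l superp_pclone_Cons)
  qed
  then show ?thesis
    using w monoid.superp_pclone_closed[OF M w ps] by (simp add: pclone_map_apply)
qed

lemma pclone_map_hom:
  assumes "monoid M" and "\<phi> \<in> monoid_hom M N"
  shows "pclone_map M \<phi> \<in> clone_hom (pclone M) (pclone N)"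
proof -
  have \<phi>: "\<phi> \<in> hom M N" "\<phi> \<one>\<^bsub>M\<^esub> = \<one>\<^bsub>N\<^esub>"
    using assms(2) by (auto simp: monoid_hom_def)
  have "pclone_map M \<phi> n (proj (pclone M) i n) = proj (pclone N) i n" if "i \<in> {1..n}" for i n
    using that \<phi>(2) monoid.one_closed[OF assms(1)]
    by (simp add: pclone_map_def elems_pclone proj_pclone)
  moreover have "\<phi> \<in> carrier M \<rightarrow> carrier N"
    using \<phi>(1) by (simp add: hom_def)
  ultimately show ?thesis
    unfolding clone_hom_def
    using pclone_map_closed pclone_map_superp[OF assms(1) \<phi>(1)] by blast
qed

lemma pclone_map_compose:
  assumes "\<phi> \<in> carrier M \<rightarrow> carrier N"
  shows "pclone_map M (compose (carrier M) \<psi> \<phi>) =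
    clone_compose (pclone M) (pclone_map N \<psi>) (pclone_map M \<phi>)"
proof (intro ext)
  fix n w
  show "pclone_map M (compose (carrier M) \<psi> \<phi>) n w =
    clone_compose (pclone M) (pclone_map N \<psi>) (pclone_map M \<phi>) n w"
  proof (cases "w \<in> elems (pclone M) n")
    case True
    \<comment> \<open>The outer map is restricted too, so the intermediate word must be a legal one
      before it can be unfolded. Off the carrier both sides are \<open>undefined\<close>.\<close>
    then have "pclone_map M \<phi> n w \<in> elems (pclone N) n"
      using pclone_map_closed[OF assms] by blast
    with True show ?thesis
      by (auto simp: clone_compose_def compose_eq pclone_map_apply)
        (auto simp: compose_def elems_pclone in_lists_conv_set)
  qed (simp add: clone_compose_def compose_def pclone_map_def)
qed

lemma pclone_map_id: "pclone_map M (\<lambda>x \<in> carrier M. x) = clone_id (pclone M)"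
  by (fastforce simp: pclone_map_def clone_id_def elems_pclone in_lists_conv_set
      intro!: ext map_idI restrict_ext)

text \<open>An injection of alphabets induces an injection of words; here the alphabet map fixes
  values and applies \<open>\<phi>\<close> to pigments.\<close>

lemma inj_on_pclone_map:
  assumes "inj_on \<phi> (carrier M)"
  shows "inj_on (pclone_map M \<phi> n) (elems (pclone M) n)"
proof -
  have "inj_on (\<lambda>(i, \<alpha>). (i, \<phi> \<alpha>)) ({1..n} \<times> carrier M)"
    using assms by (auto simp: inj_on_def)
  then have "inj_on (map (\<lambda>(i, \<alpha>). (i, \<phi> \<alpha>))) (elems (pclone M) n)"
    unfolding elems_pclone by (rule inj_on_map_lists)
  then show ?thesis
    by (simp add: pclone_map_def inj_on_restrict_eq)
qed

text \<open>A word over the image alphabet lifts letter by letter, which is the content of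
  \<open>lists_image\<close>.\<close>

lemma pclone_map_image:
  assumes "\<phi> ` carrier M = carrier N"
  shows "pclone_map M \<phi> n ` elems (pclone M) n = elems (pclone N) n"
proof -
  have "(\<lambda>(i, \<alpha>). (i, \<phi> \<alpha>)) ` ({1..n} \<times> carrier M) = {1..n} \<times> carrier N"
    using assms by force
  then show ?thesis
    by (simp add: pclone_map_def elems_pclone flip: lists_image)
qed

theorem theorem3p2p1:
  fixes M :: "('a, 'x) monoid_scheme"
    and M' :: "('b, 'y) monoid_scheme"
    and M'' :: "('c, 'z) monoid_scheme"
  assumes "monoid M" and "monoid M'" and "monoid M''"
  shows "clone (pclone M) \<and>
    (\<forall>\<phi> \<in> monoid_hom M M'. pclone_map M \<phi> \<in> clone_hom (pclone M) (pclone M')) \<and>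
    (\<forall>\<phi> \<in> monoid_hom M M'. \<forall>\<phi>' \<in> monoid_hom M' M''.
       pclone_map M (compose (carrier M) \<phi>' \<phi>) =
         clone_compose (pclone M) (pclone_map M' \<phi>') (pclone_map M \<phi>)) \<and>
    pclone_map M (\<lambda>x \<in> carrier M. x) = clone_id (pclone M) \<and>
    (\<forall>\<phi> \<in> monoid_hom M M'. inj_on \<phi> (carrier M) \<longrightarrow>
       (\<forall>n. inj_on (pclone_map M \<phi> n) (elems (pclone M) n))) \<and>
    (\<forall>\<phi> \<in> monoid_hom M M'. \<phi> ` carrier M = carrier M' \<longrightarrow>
       (\<forall>n. pclone_map M \<phi> n ` elems (pclone M) n = elems (pclone M') n))"
proof -
  have "\<phi> \<in> carrier M \<rightarrow> carrier M'" if "\<phi> \<in> monoid_hom M M'" for \<phi>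
    using that by (simp add: monoid_hom_def hom_def)
  then show ?thesis
    using assms(1)
    by (simp add: monoid.clone_pclone pclone_map_hom pclone_map_compose pclone_map_id
        inj_on_pclone_map pclone_map_image)
qed

end
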